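(* Let $\mathcal L$ be the set of covectors of an oriented matroid of rank $n$ with no loops on a finite ground set $E$, and let $\mathcal M$ be a finite set of polyhedra of full rank $n$ in $\mathcal L$. Suppose: (i) the interior of $\operatorname{Supp}(\mathcal M)$ is connected; and (ii) for every $X$ in the boundary of $\operatorname{Supp}(\mathcal M)$ there exists a closed halfspace $H^+$ bounded by a hyperplane $H$ such that $X\in H$ and $\bigcup_{M\in\mathcal M,\ X\in M}M\subseteq H^+$. Then $\operatorname{Supp}(\mathcal M)$ is a polyhedron in $\mathcal L$.
   Context: $\mathcal L\subseteq\{+,-,0\}^E$ is ordered as the face lattice ($X\le Y$ iff $X_e\in\{0,Y_e\}$ for all $e$); ranks are ranks in this poset. Closed halfspaces are the sets $H_e^+=\{X:X_e\in\{+,0\}\}$ and $H_e^-=\{X:X_e\in\{-,0\}\}$, bounded by the hyperplane $H_e=H_e^+\cap H_e^-$. A polyhedron in $\mathcal L$ is an intersection of closed halfspaces; its rank is the rank of its maximal covectors. $\operatorname{Supp}(\mathcal M)$ is the union of the members of $\mathcal M$. The boundary of an order ideal $U$ of $\mathcal L$ is the set of $X\in U$ whose principal order filter in $\mathcal L$ is not contained in $U$; the interior is $U$ minus its boundary. A set of covectors is connected if it induces a connected subgraph of the Hasse diagram of $\mathcal L$. *)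

theory Defs
  imports Main
begin

datatype sign = Neg | Zero | Pos

text \<open>
  Signs are ordered by Zero < Neg and Zero < Pos, with Neg and Pos incomparable, so that the
  pointwise order on sign vectors is the face order: X \<le> Y iff X e is Zero or Y e for all e.
\<close>

instantiation sign :: "{order, uminus}"
begin

definition less_eq_sign :: "sign \<Rightarrow> sign \<Rightarrow> bool" where
  "less_eq_sign a b \<longleftrightarrow> a = Zero \<or> a = b"

definition less_sign :: "sign \<Rightarrow> sign \<Rightarrow> bool" where
  "less_sign a b \<longleftrightarrow> a = Zero \<and> b \<noteq> Zero"

fun uminus_sign :: "sign \<Rightarrow> sign" where
  "- Neg = Pos"
| "- Zero = Zero"
| "- Pos = Neg"

instance
  by standard (auto simp: less_eq_sign_def less_sign_def)

end

text \<open>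
  A sign vector on a ground set E is a function that is Zero outside E.
\<close>

type_synonym 'e covector = "'e \<Rightarrow> sign"

definition covector_comp :: "'e covector \<Rightarrow> 'e covector \<Rightarrow> 'e covector" where
  "covector_comp X Y = (\<lambda>e. if X e \<noteq> Zero then X e else Y e)"

definition separation :: "'e covector \<Rightarrow> 'e covector \<Rightarrow> 'e set" where
  "separation X Y = {e. X e \<noteq> Zero \<and> X e = - Y e}"

locale oriented_matroid =
  fixes E :: "'e set" and L :: "'e covector set"
  assumes finite_ground: "finite E"
    and zero_outside: "\<And>X e. X \<in> L \<Longrightarrow> e \<notin> E \<Longrightarrow> X e = Zero"
    and zero_covector: "(\<lambda>e. Zero) \<in> L"
    and symmetry: "\<And>X. X \<in> L \<Longrightarrow> - X \<in> L"
    and composition: "\<And>X Y. X \<in> L \<Longrightarrow> Y \<in> L \<Longrightarrow> covector_comp X Y \<in> L"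
    and elimination: "\<And>X Y e. X \<in> L \<Longrightarrow> Y \<in> L \<Longrightarrow> e \<in> separation X Y \<Longrightarrow>
      \<exists>Z\<in>L. Z e = Zero \<and> (\<forall>f. f \<notin> separation X Y \<longrightarrow> Z f = covector_comp X Y f)"

definition loopless :: "'e set \<Rightarrow> 'e covector set \<Rightarrow> bool" where
  "loopless E L \<longleftrightarrow> (\<forall>e\<in>E. \<exists>X\<in>L. X e \<noteq> Zero)"

text \<open>
  The rank of a finite poset is the length of a longest chain in it (one less than the number of
  elements); the rank of an element is the rank of its principal order ideal.
  For the covectors L of an oriented matroid, the rank of the poset L is the rank of the oriented
  matroid.
\<close>

definition poset_rank :: "'a::order set \<Rightarrow> nat" where
  "poset_rank S = Max {card C - 1 | C. C \<subseteq> S \<and> Complete_Partial_Order.chain (\<le>) C}"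

definition covector_rank :: "'e covector set \<Rightarrow> 'e covector \<Rightarrow> nat" where
  "covector_rank L X = poset_rank {Y \<in> L. Y \<le> X}"

definition pos_halfspace :: "'e covector set \<Rightarrow> 'e \<Rightarrow> 'e covector set" where
  "pos_halfspace L e = {X \<in> L. X e \<in> {Pos, Zero}}"

definition neg_halfspace :: "'e covector set \<Rightarrow> 'e \<Rightarrow> 'e covector set" where
  "neg_halfspace L e = {X \<in> L. X e \<in> {Neg, Zero}}"

definition hyperplane :: "'e covector set \<Rightarrow> 'e \<Rightarrow> 'e covector set" where
  "hyperplane L e = pos_halfspace L e \<inter> neg_halfspace L e"

definition closed_halfspaces :: "'e set \<Rightarrow> 'e covector set \<Rightarrow> 'e covector set set" where
  "closed_halfspaces E L = pos_halfspace L ` E \<union> neg_halfspace L ` E"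

text \<open>The intersection of the empty family of halfspaces is L, so L is itself a polyhedron.\<close>

definition polyhedron :: "'e set \<Rightarrow> 'e covector set \<Rightarrow> 'e covector set \<Rightarrow> bool" where
  "polyhedron E L P \<longleftrightarrow> (\<exists>\<H>. \<H> \<subseteq> closed_halfspaces E L \<and> P = L \<inter> \<Inter>\<H>)"

text \<open>
  A polyhedron in an oriented matroid contains the zero covector and is finite, so it has maximal
  covectors; they all have the same rank.
\<close>

definition has_polyhedron_rank :: "'e covector set \<Rightarrow> 'e covector set \<Rightarrow> nat \<Rightarrow> bool" where
  "has_polyhedron_rank L P r \<longleftrightarrow>
    (\<forall>X\<in>P. (\<forall>Y\<in>P. \<not> X < Y) \<longrightarrow> covector_rank L X = r)"

definition ideal_boundary :: "'e covector set \<Rightarrow> 'e covector set \<Rightarrow> 'e covector set" where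
  "ideal_boundary L U = {X \<in> U. \<not> {Y \<in> L. X \<le> Y} \<subseteq> U}"

definition ideal_interior :: "'e covector set \<Rightarrow> 'e covector set \<Rightarrow> 'e covector set" where
  "ideal_interior L U = U - ideal_boundary L U"

text \<open>Covering is taken in L, also for the subgraph induced on a subset of L.\<close>

definition covers :: "'e covector set \<Rightarrow> 'e covector \<Rightarrow> 'e covector \<Rightarrow> bool" where
  "covers L Y X \<longleftrightarrow> X \<in> L \<and> Y \<in> L \<and> X < Y \<and> \<not> (\<exists>Z\<in>L. X < Z \<and> Z < Y)"

text \<open>As usual for graphs, a connected subgraph is nonempty.\<close>

definition hasse_connected :: "'e covector set \<Rightarrow> 'e covector set \<Rightarrow> bool" where
  "hasse_connected L S \<longleftrightarrow> S \<noteq> {} \<and>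
    (\<forall>X\<in>S. \<forall>Y\<in>S. (X, Y) \<in> {(A, B). A \<in> S \<and> B \<in> S \<and> (covers L A B \<or> covers L B A)}\<^sup>*)"

end

theory Submission
  imports Defs
begin

text \<open>
  A discrete version of the Tietze-Nakajima theorem: a connected, locally convex set is convex.
  Let S be the set of topes in the union. By (ii), a covector below two topes of S that are
  opposite to each other with respect to it is interior. Write [A,C] for the set of topes
  that lie on the side of A and C of every hyperplane not separating A from C. If B lies in [A,C] and both [A,B] and [B,C] are contained
  in S, then so is [A,C]: the property that [X o C, C] is contained in S passes between comparable
  faces X of A visible from C, because A and X o C are opposite with respect to X, and the visible
  faces form a connected poset. Walking along a path of interior covectors, this gluing shows that
  [A,B] is contained in S for all A and B in S. Finally, a tope outside S is separated from S by a
  suitable wall of a nearest tope of S.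
\<close>

section \<open>Signs and the face order\<close>

lemma sign_uminus_uminus [simp]: "- (- a) = (a::sign)"
  by (cases a) auto

lemma sign_uminus_eq_Zero [simp]: "- a = Zero \<longleftrightarrow> a = Zero"
  by (cases a) auto

lemma sign_eq_uminus [simp]: "a = - a \<longleftrightarrow> a = Zero" "- a = a \<longleftrightarrow> a = Zero"
  by (cases a; auto)+

lemma sign_neq_iff:
  fixes a b :: sign
  assumes "a \<noteq> Zero" "b \<noteq> Zero"
  shows "a \<noteq> b \<longleftrightarrow> b = - a"
  using assms by (cases a; cases b) auto

lemma covector_le_iff: "X \<le> Y \<longleftrightarrow> (\<forall>e. X e = Zero \<or> X e = Y e)" for X :: "'e covector"
  by (simp add: le_fun_def less_eq_sign_def)

lemma covector_le_nonzero: "X \<le> Y \<Longrightarrow> X e \<noteq> Zero \<Longrightarrow> Y e = X e" for X :: "'e covector"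
  by (metis covector_le_iff)

lemma covector_comp_apply: "covector_comp X Y e = (if X e \<noteq> Zero then X e else Y e)"
  by (simp add: covector_comp_def)

lemma le_covector_comp: "X \<le> covector_comp X Y"
  by (auto simp: covector_le_iff covector_comp_apply)

section \<open>Topes, intervals of topes, visible faces\<close>

context oriented_matroid
begin

definition tope :: "'e covector \<Rightarrow> bool" where
  "tope T \<longleftrightarrow> T \<in> L \<and> (\<forall>e\<in>E. T e \<noteq> Zero)"

definition tope_interval :: "'e covector \<Rightarrow> 'e covector \<Rightarrow> 'e covector set" where
  "tope_interval A C = {T. tope T \<and> (\<forall>e. A e = C e \<longrightarrow> T e = A e)}"

text \<open>
  Geometrically, the faces in the relative interior of the part of the boundary of A that is
  visible from C.
\<close>

definition visible_faces :: "'e covector \<Rightarrow> 'e covector \<Rightarrow> 'e covector set" where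
  "visible_faces A C = {X \<in> L. X \<le> A \<and> X \<noteq> A \<and> (\<forall>e. A e = C e \<longrightarrow> X e = A e)}"

lemma tope_in: "tope T \<Longrightarrow> T \<in> L"
  by (simp add: tope_def)

lemma tope_Zero_iff: "tope T \<Longrightarrow> T e = Zero \<longleftrightarrow> e \<notin> E"
  using zero_outside by (auto simp: tope_def)

lemma tope_neq: "tope A \<Longrightarrow> tope C \<Longrightarrow> A e \<noteq> C e \<Longrightarrow> C e = - A e"
  by (metis sign_neq_iff tope_Zero_iff)

lemma tope_comp: "X \<in> L \<Longrightarrow> tope T \<Longrightarrow> tope (covector_comp X T)"
  using composition by (auto simp: tope_def covector_comp_apply)

lemma finite_subset_ground: "D \<subseteq> E \<Longrightarrow> finite D"
  using finite_ground finite_subset by blast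

lemma separation_subset: "X \<in> L \<Longrightarrow> separation X Y \<subseteq> E"
  using zero_outside by (auto simp: separation_def)

lemma finite_separation: "X \<in> L \<Longrightarrow> finite (separation X Y)"
  using separation_subset finite_subset_ground by blast

lemma finite_covectors: "finite L"
proof -
  have "L \<subseteq> {f. (\<forall>x. (x \<in> E \<longrightarrow> f x \<in> {Neg, Zero, Pos}) \<and> (x \<notin> E \<longrightarrow> f x = Zero))}"
    using zero_outside sign.exhaust by auto
  moreover have "finite \<dots>"
    using finite_ground by (intro finite_set_of_finite_funs) auto
  ultimately show ?thesis
    by (rule finite_subset)
qed

section \<open>Elimination along a segment\<close>

text \<open>
  Eliminating on the segment from R towards Y as long as some element of N still separates yields
  the point of the segment nearest to Y that lies on one of the separating hyperplanes of N.
\<close>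

lemma eliminate_towards:
  assumes "Y \<in> L" "R \<in> L" "separation Y R \<inter> N \<noteq> {}"
  shows "\<exists>R'\<in>L. (\<forall>h. h \<notin> separation Y R \<longrightarrow> R' h = covector_comp Y R h)
    \<and> separation Y R' \<inter> N = {} \<and> (\<exists>g\<in>separation Y R \<inter> N. R' g = Zero)"
  using assms(2,3)
proof (induction "card (separation Y R)" arbitrary: R rule: less_induct)
  case less
  then obtain g where g: "g \<in> separation Y R" "g \<in> N" by blast
  obtain Z where Z: "Z \<in> L" "Z g = Zero"
      "\<And>f. f \<notin> separation Y R \<Longrightarrow> Z f = covector_comp Y R f"
    using elimination[OF \<open>Y \<in> L\<close> \<open>R \<in> L\<close> g(1)] by blast
  \<comment> \<open>Off the separation set \<open>Z\<close> agrees with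
    \<open>covector_comp Y R\<close>, so elimination creates no new separation from
    \<open>Y\<close>, while \<open>g\<close> drops out.\<close>
  have sub: "separation Y Z \<subseteq> separation Y R"
  proof
    fix h assume h: "h \<in> separation Y Z"
    show "h \<in> separation Y R"
    proof (rule ccontr)
      assume "h \<notin> separation Y R"
      then show False using h Z(3)[of h]
        by (auto simp: separation_def covector_comp_apply split: if_splits)
    qed
  qed
  have "g \<notin> separation Y Z"
    using Z(2) by (simp add: separation_def)
  with sub g have psub: "separation Y Z \<subset> separation Y R" by blast
  show ?case
  proof (cases "separation Y Z \<inter> N = {}")
    case True
    then show ?thesis using Z g by blast
  next
    case False
    have "card (separation Y Z) < card (separation Y R)"
      using psub finite_separation[OF assms(1)] by (simp add: psubset_card_mono)
    from less.hyps[OF this Z(1) False] obtain R' where R': "R' \<in> L"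
      "\<And>h. h \<notin> separation Y Z \<Longrightarrow> R' h = covector_comp Y Z h"
      "separation Y R' \<inter> N = {}" "\<exists>g\<in>separation Y Z \<inter> N. R' g = Zero"
      by blast
    have "R' h = covector_comp Y R h" if h: "h \<notin> separation Y R" for h
    proof -
      have "h \<notin> separation Y Z" using h sub by blast
      then show ?thesis using R'(2)[of h] Z(3)[OF h] by (auto simp: covector_comp_apply)
    qed
    then show ?thesis using R' sub by blast
  qed
qed

text \<open>Move from \<open>T\<close> towards \<open>W\<close> up to the first hyperplane met:
  nothing separates \<open>T\<close> from that point, and it vanishes wherever \<open>T\<close>
  does, so it is a face of \<open>T\<close>.\<close>

lemma exists_face_towards:
  assumes "T \<in> L" "W \<in> L" "\<And>e. T e = Zero \<Longrightarrow> W e = Zero" "separation T W \<noteq> {}"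
  shows "\<exists>Y\<in>L. Y \<le> T \<and> (\<exists>g\<in>separation T W. Y g = Zero)
    \<and> (\<forall>h. h \<notin> separation T W \<longrightarrow> Y h = T h)"
proof -
  obtain Y where Y: "Y \<in> L"
    "\<And>h. h \<notin> separation T W \<Longrightarrow> Y h = covector_comp T W h"
    "separation T Y = {}" "\<exists>g\<in>separation T W. Y g = Zero"
    using eliminate_towards[OF assms(1,2), of UNIV] assms(4) by auto
  have off: "Y h = T h" if "h \<notin> separation T W" for h
    using Y(2)[OF that] assms(3) by (simp add: covector_comp_apply)
  have "Y h = Zero \<or> Y h = T h" for h
  proof (cases "h \<in> separation T W")
    case True
    moreover have "h \<notin> separation T Y" using Y(3) by blast
    ultimately show ?thesis by (cases "T h"; cases "Y h") (auto simp: separation_def)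
  qed (simp add: off)
  then show ?thesis using Y off by (auto simp: covector_le_iff)
qed

lemma exists_visible_face:
  assumes "tope A" "tope C" "A \<noteq> C"
  shows "visible_faces A C \<noteq> {}"
proof -
  obtain e where e: "A e \<noteq> C e" using assms(3) by blast
  then have "C e = - A e" using tope_neq[OF assms(1,2)] by blast
  then have "e \<in> separation A C"
    using e by (auto simp: separation_def)
  then obtain Y where Y: "Y \<in> L" "Y \<le> A" "\<exists>g\<in>separation A C. Y g = Zero"
      "\<And>h. h \<notin> separation A C \<Longrightarrow> Y h = A h"
    using exists_face_towards[of A C] assms tope_in tope_Zero_iff by (metis empty_iff)
  have "Y h = A h" if "A h = C h" for h
    using Y(4)[of h] that by (auto simp: separation_def)
  moreover have "Y \<noteq> A"
    using Y(3) by (auto simp: separation_def)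
  ultimately show ?thesis
    using Y by (auto simp: visible_faces_def)
qed

text \<open>On the ground set, agreement of \<open>A\<close> and \<open>C\<close> at
  \<open>e\<close> would make \<open>X e\<close> nonzero; outside it both sides are
  \<open>Zero\<close>.\<close>

lemma visible_face_Zero:
  assumes "tope A" "tope C" "X \<in> visible_faces A C" "X e = Zero"
  shows "C e = - A e"
  using assms tope_neq[OF assms(1,2), of e]
  by (cases "A e = C e") (auto simp: visible_faces_def)

section \<open>Connectivity of the visible faces\<close>

text \<open>
  The visible faces form a connected poset. Geometrically, the triangle spanned by C and two
  visible faces X and Y cuts the boundary of A in a path from X to Y; R runs along the side
  of the triangle from C to Y, and the path follows the projection of R to A.
\<close>

lemma visible_faces_connected_aux:
  assumes A: "tope A" and Y: "Y \<in> visible_faces A C"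
    and G: "\<And>X X'. X \<in> visible_faces A C \<Longrightarrow> X' \<in> visible_faces A C \<Longrightarrow> X \<le> X' \<Longrightarrow>
      G X \<longleftrightarrow> G X'"
    and "X \<in> visible_faces A C" "G X" "R \<in> L"
    and "\<And>e. A e = C e \<Longrightarrow> R e = A e"
    and "\<And>e. Y e = Zero \<Longrightarrow> R e = - A e"
    and "g \<in> separation A R" "X g = Zero"
  shows "G Y"
  using assms(4-)
proof (induction "card (separation A R)" arbitrary: X R g rule: less_induct)
  \<comment> \<open>Invariant: \<open>R\<close> keeps the common signs of \<open>A\<close> and
    \<open>C\<close> and is separated from \<open>A\<close> by every hyperplane through
    \<open>Y\<close>; the current face \<open>X\<close> lies on a hyperplane \<open>g\<close>
    separating \<open>A\<close> from \<open>R\<close>.\<close>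
  case less
  note X = \<open>X \<in> visible_faces A C\<close>
  have XL: "X \<in> L" "X \<le> A" "X \<noteq> A" and XC: "\<And>e. A e = C e \<Longrightarrow> X e = A e"
    using X by (auto simp: visible_faces_def)
  have YL: "Y \<in> L" "Y \<le> A" "Y \<noteq> A" and YC: "\<And>e. A e = C e \<Longrightarrow> Y e = A e"
    using Y by (auto simp: visible_faces_def)
  have XA: "X e = Zero \<or> X e = A e" and YA: "Y e = Zero \<or> Y e = A e" for e
    using XL YL by (auto simp: covector_le_iff)
  show ?case
  proof (cases "covector_comp X Y = A")
    \<comment> \<open>Both faces lie below \<open>A\<close>, so their composition is an upper bound
      of both; it is visible and links \<open>X\<close> to \<open>Y\<close>.\<close>
    case False
    have "covector_comp X Y e = Zero \<or> covector_comp X Y e = A e" for e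
      using XA[of e] YA[of e] by (auto simp: covector_comp_apply)
    then have "covector_comp X Y \<le> A"
      by (simp add: covector_le_iff)
    moreover have "covector_comp X Y e = A e" if "A e = C e" for e
      using XC[OF that] YC[OF that] by (simp add: covector_comp_apply)
    ultimately have "covector_comp X Y \<in> visible_faces A C"
      using composition[OF XL(1) YL(1)] False by (simp add: visible_faces_def)
    moreover have "Y e = Zero \<or> Y e = covector_comp X Y e" for e
      using XA[of e] YA[of e] by (auto simp: covector_comp_apply)
    then have "Y \<le> covector_comp X Y"
      by (simp add: covector_le_iff)
    ultimately show ?thesis
      using G[OF X] G[OF Y] le_covector_comp[of X Y] \<open>G X\<close> by blast
  next
    case True
    then have XY: "X e = Zero \<Longrightarrow> Y e = A e" for e
      by (metis covector_comp_apply)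
    \<comment> \<open>\<open>N\<close> consists of the hyperplanes through \<open>X\<close>, and
      \<open>Y\<close> equals \<open>A\<close> on it. Once none of them separates \<open>R'\<close>
      from \<open>Y\<close>, \<open>covector_comp X R'\<close> is a face of \<open>A\<close>; it is
      proper because \<open>R'\<close> still lies on one of them.\<close>
    define N where "N = {e. X e = Zero \<and> A e \<noteq> Zero}"
    have "g \<in> separation Y R \<inter> N"
      using less.prems(6,7) XY[OF less.prems(7)] by (auto simp: N_def separation_def)
    then obtain R' where R': "R' \<in> L"
      "\<And>h. h \<notin> separation Y R \<Longrightarrow> R' h = covector_comp Y R h"
      "separation Y R' \<inter> N = {}" "\<exists>g\<in>separation Y R \<inter> N. R' g = Zero"
      using eliminate_towards[OF YL(1) \<open>R \<in> L\<close>, of N] by blast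
    then obtain g0 where g0: "g0 \<in> separation Y R" "g0 \<in> N" "R' g0 = Zero" by blast
    have R'C: "R' e = A e" if "A e = C e" for e
      using R'(2)[of e] YC[OF that] less.prems(4)[OF that]
      by (auto simp: separation_def covector_comp_apply)
    have R'Y: "R' e = - A e" if "Y e = Zero" for e
      using R'(2)[of e] less.prems(5)[OF that] that
      by (auto simp: separation_def covector_comp_apply)
    have sub: "separation A R' \<subseteq> separation A R"
    proof
      fix h assume h: "h \<in> separation A R'"
      show "h \<in> separation A R"
      proof (cases "h \<in> separation Y R")
        case True
        then show ?thesis using YA[of h] by (auto simp: separation_def)
      next
        case False
        then show ?thesis using h R'(2)[of h] YA[of h]
          by (auto simp: separation_def covector_comp_apply split: if_splits)
      qed
    qed
    have "g0 \<in> separation A R" "g0 \<notin> separation A R'"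
      using g0 YA[of g0] by (auto simp: separation_def)
    with sub have "separation A R' \<subset> separation A R" by blast
    then have card: "card (separation A R') < card (separation A R)"
      using finite_separation[OF tope_in[OF A]] by (simp add: psubset_card_mono)
    define F where "F = covector_comp X R'"
    have FA: "F e = Zero \<or> F e = A e" for e
    proof (cases "X e = Zero")
      case True
      show ?thesis
      proof (cases "A e = Zero")
        case True
        then show ?thesis
          using XA[of e] zero_outside[OF R'(1)] tope_Zero_iff[OF A, of e]
          by (auto simp: F_def covector_comp_apply)
      next
        case False
        then have "e \<notin> separation Y R'"
          using True R'(3) by (auto simp: N_def)
        then show ?thesis
          using True False XY[OF True]
          by (cases "A e"; cases "R' e") (auto simp: F_def covector_comp_apply separation_def)
      qed
    next
      case False
      then show ?thesis using XA[of e] by (auto simp: F_def covector_comp_apply)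
    qed
    have FL: "F \<in> L"
      using composition XL R' by (simp add: F_def)
    have Fg0: "F g0 = Zero" "A g0 \<noteq> Zero"
      using g0 by (auto simp: F_def covector_comp_apply N_def)
    have FC: "F e = A e" if "A e = C e" for e
      using XC[OF that] R'C[OF that] by (auto simp: F_def covector_comp_apply)
    have "F \<noteq> A" using Fg0 by auto
    then have F: "F \<in> visible_faces A C"
      using FL FA FC by (simp add: visible_faces_def covector_le_iff)
    have "X \<le> F" by (simp add: F_def le_covector_comp)
    with G[OF X F] \<open>G X\<close> have GF: "G F" by simp
    \<comment> \<open>A hyperplane through \<open>Y\<close> separates \<open>F\<close> from
      \<open>R'\<close>, because \<open>X\<close> has the sign of \<open>A\<close> there. So there
      is a first face \<open>X2\<close> of \<open>F\<close> towards \<open>R'\<close>, and its zero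
      \<open>g2\<close> restores the invariant.\<close>
    obtain y where "Y y \<noteq> A y"
      using YL(3) by (auto simp: fun_eq_iff)
    then have y: "Y y = Zero" "A y \<noteq> Zero"
      using YA[of y] by auto
    have "X y = A y" using y XY[of y] XA[of y] by auto
    then have "y \<in> separation F R'"
      using y R'Y[OF y(1)] by (auto simp: separation_def F_def covector_comp_apply)
    moreover have "R' e = Zero" if "F e = Zero" for e
      using that by (auto simp: F_def covector_comp_apply split: if_splits)
    ultimately obtain X2 where X2: "X2 \<in> L" "X2 \<le> F" "\<exists>g\<in>separation F R'. X2 g = Zero"
        "\<And>h. h \<notin> separation F R' \<Longrightarrow> X2 h = F h"
      using exists_face_towards[OF FL R'(1)] by blast
    then obtain g2 where g2: "g2 \<in> separation F R'" "X2 g2 = Zero" by blast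
    then have g2A: "g2 \<in> separation A R'" "A g2 \<noteq> Zero"
      using FA[of g2] by (auto simp: separation_def)
    have "X2 e = A e" if "A e = C e" for e
      using X2(4)[of e] FC[OF that] R'C[OF that] by (auto simp: separation_def)
    moreover have "X2 \<le> A"
      using X2(2) F by (auto simp: visible_faces_def)
    ultimately have X2V: "X2 \<in> visible_faces A C"
      using X2 g2 g2A by (auto simp: visible_faces_def)
    have "G X2" using G[OF X2V F X2(2)] GF by simp
    from less.hyps[OF card X2V this R'(1) R'C R'Y g2A(1) g2(2)] show ?thesis .
  qed
qed

text \<open>The walk can start at \<open>R = C\<close>: every hyperplane of the ground set through a
  visible face separates \<open>A\<close> from \<open>C\<close>.\<close>

lemma visible_faces_connected:
  assumes A: "tope A" and C: "tope C"
    and G: "\<And>X X'. X \<in> visible_faces A C \<Longrightarrow> X' \<in> visible_faces A C \<Longrightarrow> X \<le> X' \<Longrightarrow>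
      G X \<longleftrightarrow> G X'"
    and X: "X \<in> visible_faces A C" "G X" and Y: "Y \<in> visible_faces A C"
  shows "G Y"
proof -
  obtain g where "X g = Zero" "A g \<noteq> Zero"
    using X(1) by (force simp: visible_faces_def covector_le_iff fun_eq_iff)
  moreover from this have "g \<in> separation A C"
    using visible_face_Zero[OF A C X(1)] by (simp add: separation_def)
  ultimately show ?thesis
    using visible_faces_connected_aux[where G = G and R = C, OF A Y G X tope_in[OF C] sym]
      visible_face_Zero[OF A C Y] by blast
qed

section \<open>Elementary properties of tope intervals\<close>

lemma tope_intervalD: "T \<in> tope_interval A C \<Longrightarrow> A e = C e \<Longrightarrow> T e = A e"
  by (simp add: tope_interval_def)

lemma tope_interval_tope: "T \<in> tope_interval A C \<Longrightarrow> tope T"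
  by (simp add: tope_interval_def)

lemma tope_interval_mono_left:
  assumes "B \<in> tope_interval A C"
  shows "tope_interval B C \<subseteq> tope_interval A C"
  using assms by (auto simp: tope_interval_def)

lemma tope_interval_mono_right:
  assumes "B \<in> tope_interval A C"
  shows "tope_interval A B \<subseteq> tope_interval A C"
  using assms by (auto simp: tope_interval_def)

lemma tope_interval_self: "tope A \<Longrightarrow> tope_interval A A = {A}"
  by (auto simp: tope_interval_def)

lemma tope_interval_ends: "tope A \<Longrightarrow> A \<in> tope_interval A C" "tope C \<Longrightarrow> C \<in> tope_interval A C"
  by (auto simp: tope_interval_def)

lemma comp_in_tope_interval:
  assumes "X \<in> L" "X \<le> A" "tope C"
  shows "covector_comp X C \<in> tope_interval A C"
  using assms covector_le_nonzero[OF assms(2)]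
  by (auto simp: tope_interval_def tope_comp covector_comp_apply)

text \<open>\<open>A\<close> and \<open>C\<close> agree on the support of \<open>X\<close>; hence
  the topes above a covector form a convex set.\<close>

lemma tope_interval_above:
  assumes "X \<le> A" "X \<le> C" "T \<in> tope_interval A C"
  shows "X \<le> T"
  unfolding covector_le_iff
proof
  fix e
  show "X e = Zero \<or> X e = T e"
    using covector_le_nonzero[OF assms(1), of e] covector_le_nonzero[OF assms(2), of e]
      tope_intervalD[OF assms(3), of e] by metis
qed

end

section \<open>Gluing intervals under local convexity\<close>

text \<open>
  Condition (ii) enters only through antipodal: a face that is contained in two topes of S
  opposite to each other with respect to that face is interior.
\<close>

locale locally_convex_topes = oriented_matroid E L
  for E :: "'e set" and L :: "'e covector set" +
  fixes S :: "'e covector set"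
  assumes topes: "\<And>T. T \<in> S \<Longrightarrow> tope T"
    and antipodal: "\<And>X P T. X \<in> L \<Longrightarrow> X \<le> P \<Longrightarrow> P \<in> S \<Longrightarrow> covector_comp X (- P) \<in> S \<Longrightarrow>
      tope T \<Longrightarrow> X \<le> T \<Longrightarrow> T \<in> S"
begin

text \<open>Induction on the number of hyperplanes separating \<open>A\<close> from
  \<open>C\<close>. Passing from \<open>A\<close> to \<open>covector_comp X C\<close> for a visible
  face \<open>X\<close> crosses at least one of them, so shorter intervals ending at
  \<open>C\<close> may be glued.\<close>

lemma tope_interval_concat:
  assumes "tope A" "tope C" "B \<in> tope_interval A C"
    and "tope_interval A B \<subseteq> S" "tope_interval B C \<subseteq> S"
  shows "tope_interval A C \<subseteq> S"
  using assms
proof (induction "card {e. A e \<noteq> C e}" arbitrary: A B rule: less_induct)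
  case less
  note A = \<open>tope A\<close> and C = \<open>tope C\<close> and B = \<open>B \<in> tope_interval A C\<close>
  have tB: "tope B" using B by (rule tope_interval_tope)
  have AS: "A \<in> S" using less.prems(4) tope_interval_ends[OF A] by blast
  show ?case
  proof (cases "A = B")
    case True
    then show ?thesis using less.prems by simp
  next
    case False
    have card: "card {e. covector_comp X C e \<noteq> C e} < card {e. A e \<noteq> C e}"
      if X: "X \<in> visible_faces A C" for X
    proof (rule psubset_card_mono)
      show "finite {e. A e \<noteq> C e}"
        using tope_Zero_iff[OF A] tope_Zero_iff[OF C]
        by (intro finite_subset_ground) (auto, metis)
      have XA: "X e = Zero \<or> X e = A e" for e
        using X by (auto simp: visible_faces_def covector_le_iff)
      obtain g where g: "X g = Zero" "A g \<noteq> Zero"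
        using X XA by (force simp: visible_faces_def fun_eq_iff)
      then have "A g \<noteq> C g" using visible_face_Zero[OF A C X] by auto
      moreover have "covector_comp X C g = C g" using g by (simp add: covector_comp_apply)
      moreover have "{e. covector_comp X C e \<noteq> C e} \<subseteq> {e. A e \<noteq> C e}"
        using XA by (auto simp: covector_comp_apply) metis
      ultimately show "{e. covector_comp X C e \<noteq> C e} \<subset> {e. A e \<noteq> C e}" by blast
    qed
    define G where "G X \<longleftrightarrow> tope_interval (covector_comp X C) C \<subseteq> S" for X
    have step: "G X \<longleftrightarrow> G X'"
      if X: "X \<in> visible_faces A C" and X': "X' \<in> visible_faces A C" and le: "X \<le> X'" for X X'
    proof -
      have L: "X \<in> L" "X' \<in> L" "X \<le> A"
        using X X' by (auto simp: visible_faces_def)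
      have t: "tope (covector_comp X C)" "tope (covector_comp X' C)"
        using L C tope_comp by auto
      have le': "X \<le> covector_comp X' C"
        using le le_covector_comp order_trans by blast
      have in': "covector_comp X C \<in> tope_interval (covector_comp X' C) C"
        using comp_in_tope_interval[OF L(1) le' C] .
      show ?thesis
      proof
        assume "G X'"
        then show "G X" using tope_interval_mono_left[OF in'] by (auto simp: G_def)
      next
        assume GX: "G X"
        \<comment> \<open>\<open>X\<close> vanishes only where \<open>C\<close> is opposite to
          \<open>A\<close>, so \<open>antipodal\<close> applies and puts all topes above
          \<open>X\<close> into \<open>S\<close>.\<close>
        have "covector_comp X (- A) = covector_comp X C"
          using visible_face_Zero[OF A C X] by (auto simp: covector_comp_apply)
        moreover have "covector_comp X C \<in> S"
          using GX tope_interval_ends(1)[OF t(1)] by (auto simp: G_def)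
        ultimately have star: "T \<in> S" if "tope T" "X \<le> T" for T
          using antipodal[OF L(1,3) AS _ that] by simp
        \<comment> \<open>Both ends lie above \<open>X\<close>; the induction hypothesis appends the
          interval from \<open>covector_comp X C\<close> to \<open>C\<close>.\<close>
        have "tope_interval (covector_comp X' C) (covector_comp X C) \<subseteq> S"
          using star tope_interval_above[OF le' le_covector_comp] tope_interval_tope by blast
        then show "G X'"
          unfolding G_def using less.hyps[OF card[OF X'] t(2) C in'] GX by (simp add: G_def)
      qed
    qed
    \<comment> \<open>A face visible from \<open>B\<close> is visible from \<open>C\<close>, and
      beyond it \<open>B\<close> and \<open>C\<close> yield the same tope, which lies between
      \<open>A\<close> and \<open>B\<close>. The two hypotheses on \<open>B\<close> thus give
      \<open>G\<close> for this one face.\<close>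
    obtain F where F: "F \<in> visible_faces A B"
      using exists_visible_face[OF A tB False] by blast
    have FL: "F \<in> L" "F \<le> A" and FAB: "\<And>e. A e = B e \<Longrightarrow> F e = A e"
      using F by (auto simp: visible_faces_def)
    have FV: "F \<in> visible_faces A C"
      using F tope_intervalD[OF B] by (auto simp: visible_faces_def)
    have FCB: "covector_comp F C = covector_comp F B"
      using visible_face_Zero[OF A tB F] visible_face_Zero[OF A C FV]
      by (auto simp: covector_comp_apply)
    have "B \<in> tope_interval (covector_comp F C) C"
    proof -
      have "B e = C e" if "covector_comp F C e = C e" for e
      proof (cases "F e = Zero")
        case True
        then show ?thesis
          using visible_face_Zero[OF A tB F True] visible_face_Zero[OF A C FV True] by simp
      next
        case False
        then show ?thesis
          using that covector_le_nonzero[OF FL(2) False] tope_intervalD[OF B, of e]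
          by (simp add: covector_comp_apply)
      qed
      then show ?thesis using tB by (auto simp: tope_interval_def)
    qed
    moreover have "tope_interval (covector_comp F C) B \<subseteq> S"
      using tope_interval_mono_left[OF comp_in_tope_interval[OF FL tB]] less.prems(4) FCB by auto
    ultimately have "G F"
      unfolding G_def
      using less.hyps[OF card[OF FV] tope_comp[OF FL(1) C] C] less.prems(5) by blast
    then have good: "G Y" if "Y \<in> visible_faces A C" for Y
      using visible_faces_connected[where G = G, OF A C step FV _ that] \<open>G F\<close> by blast
    show ?thesis
    proof
      fix T assume T: "T \<in> tope_interval A C"
      have tT: "tope T" using T by (rule tope_interval_tope)
      show "T \<in> S"
      proof (cases "A = T")
        case True
        then show ?thesis using AS by simp
      next
        case False
        \<comment> \<open>\<open>T\<close> lies beyond a face of \<open>A\<close> visible from it,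
          hence in one of the intervals already shown to be contained in \<open>S\<close>.\<close>
        obtain Y where Y: "Y \<in> visible_faces A T"
          using exists_visible_face[OF A tT False] by blast
        have YV: "Y \<in> visible_faces A C"
          using Y tope_intervalD[OF T] by (auto simp: visible_faces_def)
        have "T e = C e" if "covector_comp Y C e = C e" for e
        proof (cases "Y e = Zero")
          case True
          then show ?thesis
            using visible_face_Zero[OF A tT Y True] visible_face_Zero[OF A C YV True] by simp
        next
          case False
          have "Y \<le> A" using Y by (simp add: visible_faces_def)
          then have "A e = Y e" using False by (rule covector_le_nonzero)
          then show ?thesis
            using that tope_intervalD[OF T, of e] False
            by (simp add: covector_comp_apply)
        qed
        then have "T \<in> tope_interval (covector_comp Y C) C"
          using tT by (auto simp: tope_interval_def)
        then show ?thesis using good[OF YV] by (auto simp: G_def)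
      qed
    qed
  qed
qed

text \<open>The tope \<open>covector_comp X A\<close> lies between \<open>A\<close> and
  \<open>B\<close> and already above \<open>X\<close>; from there to \<open>C\<close> the interval
  stays above \<open>X\<close>, so the two pieces concatenate.\<close>

lemma tope_interval_across_star:
  assumes "tope A" "tope_interval A B \<subseteq> S" "tope B"
    and X: "X \<in> L" "X \<le> B" "\<And>T. tope T \<Longrightarrow> X \<le> T \<Longrightarrow> T \<in> S"
    and C: "tope C" "X \<le> C"
  shows "tope_interval A C \<subseteq> S"
proof (rule tope_interval_concat[OF assms(1) C(1)])
  let ?B = "covector_comp X A"
  have XX: "X e \<noteq> Zero \<Longrightarrow> B e = X e \<and> C e = X e" for e
    using X(2) C(2) covector_le_nonzero by metis
  have t: "tope ?B" using X(1) assms(1) by (rule tope_comp)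
  show "?B \<in> tope_interval A C"
    using t XX by (auto simp: tope_interval_def covector_comp_apply)
  have "?B \<in> tope_interval A B"
    using t XX by (auto simp: tope_interval_def covector_comp_apply)
  then show "tope_interval A ?B \<subseteq> S"
    using tope_interval_mono_right assms(2) by blast
  show "tope_interval ?B C \<subseteq> S"
    using X(3) tope_interval_above[OF le_covector_comp C(2)] tope_interval_tope by blast
qed

end

section \<open>Separating a tope from a convex set of topes\<close>

lemma (in oriented_matroid) convex_topes_separation:
  assumes S: "\<And>T. T \<in> S \<Longrightarrow> tope T"
    and conv: "\<And>A B. A \<in> S \<Longrightarrow> B \<in> S \<Longrightarrow> tope_interval A B \<subseteq> S"
    and "S \<noteq> {}" "tope T" "T \<notin> S"
  shows "\<exists>e\<in>E. \<forall>C\<in>S. C e = - T e"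
proof -
  obtain B where B: "B \<in> S" and Bmin: "\<And>C. C \<in> S \<Longrightarrow> card {e. B e \<noteq> T e} \<le> card {e. C e \<noteq> T e}"
    using ex_has_least_nat[of "\<lambda>B. B \<in> S" _ "\<lambda>B. card {e. B e \<noteq> T e}"] assms(3) by blast
  have tB: "tope B" using S B by blast
  have "B \<noteq> T" using B assms(5) by blast
  \<comment> \<open>A visible face with fewest zeros plays the role of a wall; any ground set
    element in its zero set will separate.\<close>
  then obtain Y where Y: "Y \<in> visible_faces B T"
    and Ymin: "\<And>Z. Z \<in> visible_faces B T \<Longrightarrow> card {e\<in>E. Y e = Zero} \<le> card {e\<in>E. Z e = Zero}"
    using ex_has_least_nat[of "\<lambda>Y. Y \<in> visible_faces B T" _ "\<lambda>Y. card {e\<in>E. Y e = Zero}"]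
      exists_visible_face[OF tB assms(4)] by blast
  have YL: "Y \<in> L" "Y \<le> B" "Y \<noteq> B" and YT: "\<And>e. B e = T e \<Longrightarrow> Y e = B e"
    using Y by (auto simp: visible_faces_def)
  have YB: "Y e = Zero \<or> Y e = B e" for e
    using YL by (auto simp: covector_le_iff)
  obtain g where "Y g \<noteq> B g"
    using YL(3) by (auto simp: fun_eq_iff)
  then have g: "Y g = Zero" "B g \<noteq> Zero"
    using YB[of g] by auto
  have gE: "g \<in> E" using g tope_Zero_iff[OF tB] by blast
  have BT: "T e = - B e" if "Y e = Zero" for e
    using visible_face_Zero[OF tB assms(4) Y that] .
  let ?B = "covector_comp Y T"
  \<comment> \<open>Crossing \<open>Y\<close> changes signs only to those of \<open>T\<close>, so
    \<open>?B\<close> is nearer to \<open>T\<close> than \<open>B\<close>.\<close>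
  have "?B \<notin> S"
  proof
    assume "?B \<in> S"
    moreover have "card {e. ?B e \<noteq> T e} < card {e. B e \<noteq> T e}"
    proof (rule psubset_card_mono)
      show "finite {e. B e \<noteq> T e}"
        using tope_Zero_iff[OF tB] tope_Zero_iff[OF assms(4)]
        by (intro finite_subset_ground) (auto, metis)
      have "?B g = T g" "B g \<noteq> T g"
        using g BT[OF g(1)] by (auto simp: covector_comp_apply)
      moreover have "{e. ?B e \<noteq> T e} \<subseteq> {e. B e \<noteq> T e}"
        using YB by (auto simp: covector_comp_apply) metis
      ultimately show "{e. ?B e \<noteq> T e} \<subset> {e. B e \<noteq> T e}" by blast
    qed
    ultimately show False using Bmin[of ?B] by simp
  qed
  have "C g = B g" if C: "C \<in> S" for C
  proof (rule ccontr)
    assume Cg: "C g \<noteq> B g"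
    have tC: "tope C" using S C by blast
    have "?B \<notin> tope_interval B C"
      using conv[OF B C] \<open>?B \<notin> S\<close> by blast
    moreover have "tope ?B" using tope_comp YL assms(4) by blast
    ultimately obtain f where f: "B f = C f" "?B f \<noteq> B f"
      by (auto simp: tope_interval_def)
    have fY: "Y f = Zero" using f YB[of f] by (auto simp: covector_comp_apply split: if_splits)
    then have fE: "f \<in> E"
      using f tope_Zero_iff[OF tB, of f] tope_Zero_iff[OF assms(4), of f]
      by (auto simp: covector_comp_apply)
    \<comment> \<open>Turning around \<open>Y\<close> towards \<open>C\<close> flips
      \<open>g\<close> but not \<open>f\<close>. A face of \<open>B\<close> visible from
      \<open>?D\<close> has its zeros among those of \<open>Y\<close> and is nonzero at
      \<open>f\<close>, against the choice of \<open>Y\<close>.\<close>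
    let ?D = "covector_comp Y C"
    have tD: "tope ?D" using tope_comp YL tC by blast
    have "B \<noteq> ?D" using g Cg by (metis covector_comp_apply)
    then obtain Z where Z: "Z \<in> visible_faces B ?D"
      using exists_visible_face[OF tB tD] by blast
    have ZD: "Z e = B e" if "B e = ?D e" for e
      using Z that by (auto simp: visible_faces_def)
    have ZY: "Z e = B e" if "Y e \<noteq> Zero" for e
      using ZD[of e] that YB[of e] by (auto simp: covector_comp_apply)
    have "Z e = B e" if "B e = T e" for e
    proof (cases "Y e = Zero")
      case True
      then have "B e = Zero" using BT[of e] that by simp
      then show ?thesis using Z covector_le_nonzero[of Z B e] by (auto simp: visible_faces_def)
    qed (rule ZY)
    then have "Z \<in> visible_faces B T"
      using Z by (simp add: visible_faces_def)
    from Ymin[OF this] have "card {e\<in>E. Y e = Zero} \<le> card {e\<in>E. Z e = Zero}" .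
    moreover have "card {e\<in>E. Z e = Zero} < card {e\<in>E. Y e = Zero}"
    proof (rule psubset_card_mono)
      show "finite {e\<in>E. Y e = Zero}" using finite_ground by simp
      have "Z f = B f" using ZD[of f] f fY by (simp add: covector_comp_apply)
      then have "Z f \<noteq> Zero" using fE tope_Zero_iff[OF tB] by simp
      moreover have "{e\<in>E. Z e = Zero} \<subseteq> {e\<in>E. Y e = Zero}"
        using ZY tope_Zero_iff[OF tB] by (metis (mono_tags, lifting) Collect_mono)
      ultimately show "{e\<in>E. Z e = Zero} \<subset> {e\<in>E. Y e = Zero}" using fE fY by blast
    qed
    ultimately show False by simp
  qed
  then show ?thesis using BT[OF g(1)] gE by (intro bexI[of _ g]) auto
qed

section \<open>Rank, halfspaces and polyhedra\<close>

text \<open>Without loops, a covector vanishing somewhere on \<open>E\<close> has a strictly larger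
  covector, which can be put on top of a longest chain below it.\<close>

lemma (in oriented_matroid) tope_if_full_rank:
  assumes "loopless E L" "X \<in> L" "covector_rank L X = poset_rank L"
  shows "tope X"
proof (rule ccontr)
  assume "\<not> tope X"
  then obtain e Z where "e \<in> E" "X e = Zero" "Z \<in> L" "Z e \<noteq> Zero"
    using assms by (auto simp: tope_def loopless_def)
  define Y where "Y = covector_comp X Z"
  have "Y e \<noteq> X e"
    using \<open>X e = Zero\<close> \<open>Z e \<noteq> Zero\<close> by (simp add: Y_def covector_comp_apply)
  then have Y: "Y \<in> L" "X \<le> Y" "X \<noteq> Y"
    using composition[OF \<open>X \<in> L\<close> \<open>Z \<in> L\<close>] le_covector_comp[of X Z] by (auto simp: Y_def)
  let ?ch = "\<lambda>S. {card C - 1 | C. C \<subseteq> S \<and> Complete_Partial_Order.chain (\<le>) C}"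
  have fin: "finite (?ch S)" if "S \<subseteq> L" for S
  proof -
    have "?ch S \<subseteq> (\<lambda>C. card C - 1) ` Pow L" using that by auto
    then show ?thesis using finite_covectors finite_subset by blast
  qed
  let ?I = "{Y \<in> L. Y \<le> X}"
  have "Max (?ch ?I) \<in> ?ch ?I"
    by (intro Max_in fin) (auto intro!: exI[of _ "{}"] simp: Complete_Partial_Order.chain_def)
  then obtain C where C: "C \<subseteq> ?I" "Complete_Partial_Order.chain (\<le>) C"
      "covector_rank L X = card C - 1"
    unfolding covector_rank_def poset_rank_def by blast
  \<comment> \<open>The truncated \<open>card C - 1\<close> is 0 for the empty chain as for a
    singleton; only for a nonempty chain does one more element raise the value.\<close>
  define C' where "C' = (if C = {} then {X} else C)"
  have C': "C' \<subseteq> ?I" "Complete_Partial_Order.chain (\<le>) C'" "card C' - 1 = covector_rank L X" "C' \<noteq> {}"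
    using C \<open>X \<in> L\<close> by (auto simp: C'_def Complete_Partial_Order.chain_def)
  have finC: "finite C'" using C'(1) by (intro finite_subset[OF _ finite_covectors]) auto
  have le: "D \<le> Y" if "D \<in> C'" for D
    using C'(1) that Y(2) by (auto intro: order_trans)
  have "Y \<notin> C'" using C'(1) Y by auto
  then have "card (insert Y C') = Suc (card C')" using finC by simp
  moreover have "insert Y C' \<subseteq> L" "Complete_Partial_Order.chain (\<le>) (insert Y C')"
    using C' Y le by (auto simp: Complete_Partial_Order.chain_def)
  then have "card (insert Y C') - 1 \<le> poset_rank L"
    unfolding poset_rank_def by (intro Max_ge fin) auto
  moreover have "card C' \<ge> 1" using finC C'(4) by (simp add: Suc_le_eq card_gt_0_iff)
  ultimately show False using C'(3) assms(3) by linarith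
qed

lemma closed_halfspace_comp:
  assumes "oriented_matroid E L" "H \<in> closed_halfspaces E L" "X \<in> H" "Y \<in> H"
  shows "covector_comp X Y \<in> H"
  using assms oriented_matroid.composition[OF assms(1), of X Y]
  by (auto simp: closed_halfspaces_def pos_halfspace_def neg_halfspace_def covector_comp_apply)

lemma polyhedron_subset: "polyhedron E L M \<Longrightarrow> M \<subseteq> L"
  by (auto simp: polyhedron_def)

lemma polyhedron_downward_closed:
  assumes "polyhedron E L M" "X \<in> M" "Y \<in> L" "Y \<le> X"
  shows "Y \<in> M"
proof -
  obtain \<H> where H: "\<H> \<subseteq> closed_halfspaces E L" "M = L \<inter> \<Inter>\<H>"
    using assms(1) by (auto simp: polyhedron_def)
  have "Y \<in> H" if "H \<in> \<H>" for H
  proof -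
    have "X \<in> H" "H \<in> closed_halfspaces E L" using H that assms(2) by auto
    moreover have "Y e = Zero \<or> Y e = X e" for e using assms(4) by (simp add: covector_le_iff)
    ultimately show ?thesis using assms(3)
      by (auto simp: closed_halfspaces_def pos_halfspace_def neg_halfspace_def) metis+
  qed
  then show ?thesis using H assms(3) by blast
qed

section \<open>The union of the polyhedra\<close>

theorem theorem5p6:
  fixes E :: "'e set" and L :: "'e covector set" and n :: nat
    and \<M> :: "'e covector set set"
  assumes "oriented_matroid E L"
    and "loopless E L"
    and "poset_rank L = n"
    and "finite \<M>"
    and "\<And>M. M \<in> \<M> \<Longrightarrow> polyhedron E L M \<and> has_polyhedron_rank L M n"
    and "hasse_connected L (ideal_interior L (\<Union>\<M>))"
    and "\<And>X. X \<in> ideal_boundary L (\<Union>\<M>) \<Longrightarrow>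
      \<exists>e\<in>E. \<exists>H\<in>{pos_halfspace L e, neg_halfspace L e}.
        X \<in> hyperplane L e \<and> \<Union>{M \<in> \<M>. X \<in> M} \<subseteq> H"
  shows "polyhedron E L (\<Union>\<M>)"
proof -
  interpret oriented_matroid E L by fact
  define U where "U = \<Union>\<M>"
  define S where "S = {T \<in> U. tope T}"
  have UL: "U \<subseteq> L"
    using assms(5) polyhedron_subset by (fastforce simp: U_def)
  have down: "Y \<in> U" if "X \<in> U" "Y \<in> L" "Y \<le> X" for X Y
    using assms(5) that polyhedron_downward_closed by (fastforce simp: U_def)
  \<comment> \<open>A maximal covector of a member has full rank and is thus a tope; with
    \<open>down\<close>, \<open>U\<close> is determined by its topes.\<close>
  have above: "\<exists>T\<in>S. X \<le> T" if XU: "X \<in> U" for X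
  proof -
    obtain M where M: "M \<in> \<M>" "X \<in> M" using XU by (auto simp: U_def)
    have "finite M"
      using assms(5)[OF M(1)] finite_subset[OF polyhedron_subset finite_covectors] by blast
    then obtain T where T: "T \<in> M" "X \<le> T" "\<And>Z. Z \<in> M \<Longrightarrow> T \<le> Z \<Longrightarrow> T = Z"
      using finite_has_maximal2[OF _ M(2)] by metis
    then have "covector_rank L T = n"
      using assms(5)[OF M(1)] unfolding has_polyhedron_rank_def by (metis less_le)
    moreover have "T \<in> L" using T(1) assms(5)[OF M(1)] polyhedron_subset by blast
    ultimately have "tope T" using tope_if_full_rank[OF assms(2)] assms(3) by simp
    then show ?thesis using T M(1) by (auto simp: S_def U_def)
  qed
  have interior: "Y \<in> U" if "X \<in> ideal_interior L U" "Y \<in> L" "X \<le> Y" for X Y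
    using that by (auto simp: ideal_interior_def ideal_boundary_def)
  interpret locally_convex_topes E L S
  proof
    show "tope T" if "T \<in> S" for T using that by (simp add: S_def)
  next
    fix X P T
    assume X: "X \<in> L" "X \<le> P" "P \<in> S" "covector_comp X (- P) \<in> S" and T: "tope T" "X \<le> T"
    let ?Q = "covector_comp X (- P)"
    have XU: "X \<in> U" using X down by (auto simp: S_def)
    have "X \<in> ideal_interior L U"
    proof (rule ccontr)
      assume "X \<notin> ideal_interior L U"
      then have "X \<in> ideal_boundary L (\<Union>\<M>)"
        using XU unfolding ideal_interior_def U_def by blast
      \<comment> \<open>\<open>P\<close> and \<open>?Q\<close> lie above \<open>X\<close>, so each
        lies in a member containing \<open>X\<close> and hence in \<open>H\<close>. But their signs
        at \<open>e\<close> are opposite and nonzero.\<close>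
      from assms(7)[OF this] obtain e H where e: "e \<in> E" "X \<in> hyperplane L e"
        and H: "H = pos_halfspace L e \<or> H = neg_halfspace L e" "\<Union>{M \<in> \<M>. X \<in> M} \<subseteq> H"
        by blast
      have inH: "Z \<in> H" if ZU: "Z \<in> U" "X \<le> Z" for Z
      proof -
        obtain M where M: "M \<in> \<M>" "Z \<in> M" using ZU by (auto simp: U_def)
        then have "X \<in> M"
          using assms(5)[OF M(1)] polyhedron_downward_closed X(1) ZU(2) by blast
        then show ?thesis using M H(2) by blast
      qed
      have "P \<in> H" "?Q \<in> H"
        using inH X le_covector_comp[of X "- P"] by (auto simp: S_def)
      moreover have Xe: "X e = Zero"
        using e by (auto simp: hyperplane_def pos_halfspace_def neg_halfspace_def)
      moreover have "P e \<noteq> Zero" using X(3) e(1) by (simp add: S_def tope_def)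
      ultimately show False
        using H(1)
        by (cases "P e") (auto simp: pos_halfspace_def neg_halfspace_def covector_comp_apply)
    qed
    then show "T \<in> S" using interior T tope_in by (auto simp: S_def)
  qed
  have conv: "tope_interval A B \<subseteq> S" if A: "A \<in> S" and B: "B \<in> S" for A B
  proof -
    \<comment> \<open>Nothing lies strictly above a tope, so the topes of \<open>S\<close> can serve
      as ends of paths in the interior.\<close>
    have int: "T \<in> ideal_interior L U" if "T \<in> S" for T
    proof -
      have "Y = T" if "Y \<in> L" "T \<le> Y" for Y
      proof
        fix e
        show "Y e = T e"
          using \<open>T \<in> S\<close> that zero_outside[of Y e] zero_outside[of T e] covector_le_nonzero[of T Y e]
          by (cases "e \<in> E") (auto simp: S_def tope_def)
      qed
      then show ?thesis using that by (auto simp: ideal_interior_def ideal_boundary_def S_def)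
    qed
    \<comment> \<open>Quantifying over all topes above \<open>X\<close> lets the property pass along
      the path: \<open>across\<close> needs only one such tope, and comparable covectors of
      \<open>U\<close> share one in \<open>S\<close>.\<close>
    let ?good = "\<lambda>X. \<forall>T. tope T \<and> X \<le> T \<longrightarrow> tope_interval A T \<subseteq> S"
    have across: "?good X" if X: "X \<in> ideal_interior L U" and "tope T" "X \<le> T"
      "tope_interval A T \<subseteq> S" for X T
    proof -
      have "X \<in> L" using X UL by (auto simp: ideal_interior_def)
      moreover have "T' \<in> S" if "tope T'" "X \<le> T'" for T'
        using interior[OF X tope_in[OF that(1)] that(2)] that(1) by (simp add: S_def)
      ultimately show ?thesis
        using tope_interval_across_star[OF topes[OF A] that(4,2) _ that(3)] by blast
    qed
    have tA: "tope A" using topes A by blast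
    have "(A, B) \<in> {(A, B). A \<in> ideal_interior L U \<and> B \<in> ideal_interior L U
        \<and> (covers L A B \<or> covers L B A)}\<^sup>*"
      using assms(6) int[OF A] int[OF B] unfolding hasse_connected_def U_def by blast
    then have "?good B"
    proof (induction rule: rtrancl_induct)
      case base
      show ?case
        using across[OF int[OF A] tA order_refl] tope_interval_self[OF tA] A by auto
    next
      case (step X Y)
      then have XY: "X \<in> ideal_interior L U" "Y \<in> ideal_interior L U" "X \<le> Y \<or> Y \<le> X"
        by (auto simp: covers_def)
      obtain T where T: "tope T" "X \<le> T" "Y \<le> T"
      proof -
        have "X \<in> U" "Y \<in> U" using XY by (auto simp: ideal_interior_def)
        then show thesis using above[of X] above[of Y] XY(3) that
          by (metis order_trans topes)
      qed
      then show ?case using across[OF XY(2) T(1,3)] step.IH by blast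
    qed
    then show ?thesis using topes[OF B] by blast
  qed
  have "U \<noteq> {}"
    using assms(6) by (auto simp: hasse_connected_def ideal_interior_def U_def)
  then obtain B where B: "B \<in> S" using above by blast
  define \<H> where "\<H> = {H \<in> closed_halfspaces E L. U \<subseteq> H}"
  have "U = L \<inter> \<Inter>\<H>"
  proof
    show "U \<subseteq> L \<inter> \<Inter>\<H>" using UL by (auto simp: \<H>_def)
    show "L \<inter> \<Inter>\<H> \<subseteq> U"
    proof
      fix X assume X: "X \<in> L \<inter> \<Inter>\<H>"
      \<comment> \<open>Halfspaces are closed under composition, so \<open>T\<close> still lies in
        all members of \<open>\<H>\<close>; as \<open>X\<close> is a face of \<open>T\<close>, it
        suffices to treat topes.\<close>
      define T where "T = covector_comp X B"
      have T: "tope T" using X topes[OF B] tope_comp by (auto simp: T_def)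
      have "B \<in> U" using B by (simp add: S_def)
      then have TH: "T \<in> H" if "H \<in> \<H>" for H
        using closed_halfspace_comp[OF assms(1), of H X B] that X unfolding T_def \<H>_def by blast
      have "T \<in> S"
      proof (rule ccontr)
        assume "T \<notin> S"
        from convex_topes_separation[OF topes conv _ T this] B
        obtain e where e: "e \<in> E" "\<And>C. C \<in> S \<Longrightarrow> C e = - T e" by blast
        \<comment> \<open>Every covector of \<open>U\<close> lies below a tope of \<open>S\<close>,
          so the halfspace at \<open>e\<close> opposite to \<open>T\<close> contains
          \<open>U\<close> and belongs to \<open>\<H>\<close>, yet misses \<open>T\<close>.\<close>
        have Ue: "X e = Zero \<or> X e = - T e" if "X \<in> U" for X
          using above[OF that] e(2) covector_le_nonzero by metis
        show False
        proof (cases "T e")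
          case Zero
          then show False using T e(1) by (simp add: tope_def)
        next
          case Pos
          then have "U \<subseteq> neg_halfspace L e"
            using Ue UL by (auto simp: neg_halfspace_def)
          then have "T \<in> neg_halfspace L e"
            using TH e(1) by (auto simp: \<H>_def closed_halfspaces_def)
          with Pos show False by (simp add: neg_halfspace_def)
        next
          case Neg
          then have "U \<subseteq> pos_halfspace L e"
            using Ue UL by (auto simp: pos_halfspace_def)
          then have "T \<in> pos_halfspace L e"
            using TH e(1) by (auto simp: \<H>_def closed_halfspaces_def)
          with Neg show False by (simp add: pos_halfspace_def)
        qed
      qed
      then show "X \<in> U"
        using down[of T X] X le_covector_comp[of X B] by (auto simp: S_def T_def)
    qed
  qed
  then show ?thesis
    unfolding polyhedron_def U_def by (auto simp: \<H>_def intro!: exI[of _ \<H>])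
qed

end
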